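(* Let $r$ be a non-negative integer. All the absentee circles of $\mathbf S_\cup^{\mathbb Z}(r)$ corresponding to Octant 1 lie in $$\mathcal F_1:=\{\mathbf P_{h,1}\cap\mathbb Z_1^3:\ h=0,1,2,\ldots\},$$ where $$\mathbf P_{h,1}=\overline{\mathbf P}_{h,1}\setminus\underline{\mathbf P}_{h,1}$$ such that $$\underline{\mathbf P}_{h,1}: x^2+z^2<(2h+1)y+h^2,\qquad \overline{\mathbf P}_{h,1}: x^2+z^2<(2h+1)y+(h+1)^2.$$
   Context: Digital circle of integer radius $r\ge 0$: $\mathcal C^{\mathbb Z}(r)=\{(i,j)\in\mathbb Z^2: |\max(|i|,|j|)-\sqrt{r^2-\min(|i|,|j|)^2}|<\tfrac12\}$ (points for which the square root is not real are excluded). Digital disc: $\mathcal D^{\mathbb Z}(r)$ is the set of all $(i,j_c)\in\mathbb Z^2$ for which there is $(i_c,j_c)\in\mathcal C^{\mathbb Z}(r)$ with $i$ between $0$ and $i_c$ inclusive. The disc absentees of radius $r$ are the elements of $\mathcal D^{\mathbb Z}(r)\setminus\bigcup_{s=0}^{r}\mathcal C^{\mathbb Z}(s)$. Octant 1 of the $xy$-plane is $\{0\le x\le y\}$; $\mathbb Z_1^2$ denotes the points of $\mathbb Z^2$ in Octant 1, and correspondingly $\mathbb Z_1^3$ denotes the Octant 1 part of $\mathbb Z^3$, i.e. the voxels $(x,y,z)\in\mathbb Z^3$ with $0\le x\le y$. $\mathbf S_\cup^{\mathbb Z}(r)$ denotes the union of the complete digital spheres of revolution (about the $y$-axis) of radii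 $0,1,\dots,r$ centered at the origin of $\mathbb Z^3$, with coordinates $(x,y,z)$. For each disc absentee $(i,j)$ of radius $r$ in the first quadrant of the $xy$-plane, the corresponding absentee circle of $\mathbf S_\cup^{\mathbb Z}(r)$ is $\mathbf C_{(i,j)}=\{(i',j,k')\in\mathbb Z^3:(i',k')\in\mathcal C^{\mathbb Z}(i)\}$, i.e. the digital circle of radius $i$ with center $(0,j,0)$ in the plane $y=j$. It corresponds to Octant 1 if $0\le i\le j$. Each $\underline{\mathbf P}_{h,1}$, $\overline{\mathbf P}_{h,1}$ is the set of points $(x,y,z)$ of real 3-space satisfying the stated inequality.
   Formalization: Containment of all voxels of the digital absentee circle fails (r=5, absentee (2,4), voxel (1,4,2)); proved instead: the real circle lies in one P_{h,1}, its Octant 1 voxels on that real circle lie in P_{h,1}∩Z_1^3, and every voxel has a point of P_{h,1} in its horizontal unit cell. *)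

theory Defs
  imports Complex_Main
begin

type_synonym pixel = "int \<times> int"
type_synonym voxel = "int \<times> int \<times> int"

text \<open>The real square root of HOL is total, so the condition that its argument is
  nonnegative has to be stated separately.\<close>

definition digital_circle :: "nat \<Rightarrow> pixel set" where
  "digital_circle r = {(i, j).
     (min \<bar>i\<bar> \<bar>j\<bar>)\<^sup>2 \<le> (int r)\<^sup>2 \<and>
     \<bar>real_of_int (max \<bar>i\<bar> \<bar>j\<bar>) - sqrt (real_of_int ((int r)\<^sup>2 - (min \<bar>i\<bar> \<bar>j\<bar>)\<^sup>2))\<bar> < 1 / 2}"

definition digital_disc :: "nat \<Rightarrow> pixel set" where
  "digital_disc r = {(i, jc). \<exists>ic. (ic, jc) \<in> digital_circle r \<and> min 0 ic \<le> i \<and> i \<le> max 0 ic}"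

definition disc_absentees :: "nat \<Rightarrow> pixel set" where
  "disc_absentees r = digital_disc r - (\<Union>s\<in>{0..r}. digital_circle s)"

definition absentee_circle :: "int \<Rightarrow> int \<Rightarrow> voxel set" where
  "absentee_circle i j = {(i', y, k'). y = j \<and> (i', k') \<in> digital_circle (nat i)}"

text \<open>The circle of real 3-space that the digital circle above digitizes: the orbit of
  \<open>(i, j, 0)\<close> under rotation about the \<open>y\<close>-axis.\<close>

definition real_circle :: "int \<Rightarrow> int \<Rightarrow> (real \<times> real \<times> real) set" where
  "real_circle i j = {(x, y, z). y = of_int j \<and> x\<^sup>2 + z\<^sup>2 = (of_int i)\<^sup>2}"

definition octant1 :: "voxel set" where
  "octant1 = {(x, y, z). 0 \<le> x \<and> x \<le> y}"

definition P_lower :: "nat \<Rightarrow> (real \<times> real \<times> real) set" where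
  "P_lower h = {(x, y, z). x\<^sup>2 + z\<^sup>2 < (2 * real h + 1) * y + (real h)\<^sup>2}"

definition P_upper :: "nat \<Rightarrow> (real \<times> real \<times> real) set" where
  "P_upper h = {(x, y, z). x\<^sup>2 + z\<^sup>2 < (2 * real h + 1) * y + (real h + 1)\<^sup>2}"

definition P :: "nat \<Rightarrow> (real \<times> real \<times> real) set" where
  "P h = P_upper h - P_lower h"

definition real_point :: "voxel \<Rightarrow> real \<times> real \<times> real" where
  "real_point = (\<lambda>(x, y, z). (of_int x, of_int y, of_int z))"

definition F1 :: "nat \<Rightarrow> voxel set" where
  "F1 h = {v \<in> octant1. real_point v \<in> P h}"

text \<open>The voxels whose horizontal cell (the open unit square around the voxel in its plane of
  constant \<open>y\<close>) meets a given set.\<close>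

definition digitization :: "(real \<times> real \<times> real) set \<Rightarrow> voxel set" where
  "digitization A = {(x, y, z). \<exists>u w. (u, of_int y, w) \<in> A \<and>
     \<bar>u - of_int x\<bar> < 1 / 2 \<and> \<bar>w - of_int z\<bar> < 1 / 2}"

text \<open>A voxel of an absentee circle need not be at distance exactly \<open>i\<close> from the axis, and then
  it can miss every member of the family \<open>F1\<close>, even if it is in Octant 1. Hence containment
  in \<open>F1 h\<close> can hold only up to digitization for the digital circle as a whole. The smallest
  example is the absentee \<open>(2, 4)\<close>, whose circle has the voxel \<open>(1, 4, 2)\<close>, where
  \<open>x\<^sup>2 + z\<^sup>2 = 5\<close>.\<close>

lemma absentee_circle_voxel_outside_F1:
  "(2, 4) \<in> disc_absentees 5"
  "(1, 4, 2) \<in> absentee_circle 2 4 \<inter> octant1"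
  "\<And>h. (1, 4, 2) \<notin> F1 h"
proof -
  have s1: "sqrt 3 > 3/2" "sqrt 3 < 5/2" by (rule real_less_rsqrt real_less_lsqrt; simp add: power2_eq_square)+
  have s2: "sqrt 21 > 9/2" by (rule real_less_rsqrt) (simp add: power2_eq_square)
  have s3: "sqrt 12 < 7/2" by (rule real_less_lsqrt) (simp_all add: power2_eq_square)
  have s5: "sqrt 5 < 7/2" by (rule real_less_lsqrt) (simp_all add: power2_eq_square)
  have "(3, 4) \<in> digital_circle 5"
    by (simp add: digital_circle_def)
  then have d: "(2, 4) \<in> digital_disc 5"
    unfolding digital_disc_def by force
  have "(2, 4) \<notin> digital_circle s" if "s \<le> 5" for s
  proof -
    from that have "s = 0 \<or> s = 1 \<or> s = 2 \<or> s = 3 \<or> s = 4 \<or> s = 5" by linarith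
    then show ?thesis
      using s2 s3 s5 by (auto simp: digital_circle_def abs_if)
  qed
  with d show "(2, 4) \<in> disc_absentees 5"
    by (auto simp: disc_absentees_def)
  show "(1, 4, 2) \<in> absentee_circle 2 4 \<inter> octant1"
    using s1 by (auto simp: absentee_circle_def octant1_def digital_circle_def abs_if)
  fix h
  show "(1, 4, 2) \<notin> F1 h"
  proof (cases h)
    case 0
    then show ?thesis by (simp add: F1_def real_point_def P_def P_upper_def)
  next
    case (Suc n)
    have "0 \<le> (real n)\<^sup>2" by simp
    then have "(5::real) < (2 * real h + 1) * 4 + (real h)\<^sup>2"
      using Suc by (simp add: power2_eq_square algebra_simps add_nonneg_pos)
    then show ?thesis by (simp add: F1_def real_point_def P_def P_lower_def)
  qed
qed

end

theory Submission
  imports Defs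
begin

text \<open>A pixel \<open>(i, j) \<noteq> (0, 0)\<close> with \<open>0 \<le> i \<le> j\<close> lies on the digital circle of radius \<open>s\<close> iff
  \<open>s\<^sup>2\<close> lies in the interval \<open>(i\<^sup>2 + j\<^sup>2 - j, i\<^sup>2 + j\<^sup>2 + j]\<close>, so an absentee is a pixel whose
  interval contains no square. If \<open>s\<close> is maximal with \<open>s\<^sup>2 \<le> i\<^sup>2 + j\<^sup>2 - j\<close>, then
  \<open>i\<^sup>2 + j\<^sup>2 + j < (s + 1)\<^sup>2\<close>, and with \<open>h = s - j\<close> these two inequalities are exactly the ones that
  define \<open>P h\<close>.\<close>

text \<open>Squaring \<open>M - 1/2 < sqrt D < M + 1/2\<close> leaves a term 1/4 on each side, which
  integrality absorbs: the lower bound stays strict, the upper one becomes weak. The origin is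
  excluded because there \<open>M - 1/2\<close> is negative: it lies on the circle of radius 0
  although the interval is empty.\<close>

lemma mem_digital_circle_iff:
  assumes "(i, j) \<noteq> (0, 0)"
  shows "(i, j) \<in> digital_circle r \<longleftrightarrow>
    i\<^sup>2 + j\<^sup>2 - max \<bar>i\<bar> \<bar>j\<bar> < (int r)\<^sup>2 \<and> (int r)\<^sup>2 \<le> i\<^sup>2 + j\<^sup>2 + max \<bar>i\<bar> \<bar>j\<bar>"
proof -
  define m where "m = min \<bar>i\<bar> \<bar>j\<bar>"
  define M where "M = max \<bar>i\<bar> \<bar>j\<bar>"
  define D where "D = (int r)\<^sup>2 - m\<^sup>2"
  have M: "M \<ge> 1" using assms by (auto simp: M_def)
  have sum: "i\<^sup>2 + j\<^sup>2 = m\<^sup>2 + M\<^sup>2" by (auto simp: m_def M_def min_def max_def)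
  have "M \<le> M\<^sup>2" using M by (simp add: power2_eq_square)
  \<comment> \<open>So the lower bound alone makes the square root real.\<close>
  then have nonneg: "0 \<le> D" if "M\<^sup>2 - M < D" using that by linarith
  have lower: "real_of_int M - 1/2 < sqrt D \<longleftrightarrow> M\<^sup>2 - M < D"
  proof -
    have "real_of_int M - 1/2 < sqrt D \<longleftrightarrow> (real_of_int M - 1/2)\<^sup>2 < D"
      using M real_sqrt_less_iff[of "(real_of_int M - 1/2)\<^sup>2" D] by simp
    also have "\<dots> \<longleftrightarrow> real_of_int (M\<^sup>2 - M) + 1/4 < real_of_int D"
      by (simp add: power2_eq_square algebra_simps)
    also have "\<dots> \<longleftrightarrow> M\<^sup>2 - M < D" by linarith
    finally show ?thesis .
  qed
  have upper: "sqrt D < real_of_int M + 1/2 \<longleftrightarrow> D \<le> M\<^sup>2 + M"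
  proof -
    have "sqrt D < real_of_int M + 1/2 \<longleftrightarrow> real_of_int D < (real_of_int M + 1/2)\<^sup>2"
      using M real_sqrt_less_iff[of D "(real_of_int M + 1/2)\<^sup>2"] by simp
    also have "\<dots> \<longleftrightarrow> real_of_int D < real_of_int (M\<^sup>2 + M) + 1/4"
      by (simp add: power2_eq_square algebra_simps)
    also have "\<dots> \<longleftrightarrow> D \<le> M\<^sup>2 + M" by linarith
    finally show ?thesis .
  qed
  have "(i, j) \<in> digital_circle r \<longleftrightarrow> 0 \<le> D \<and> \<bar>real_of_int M - sqrt D\<bar> < 1/2"
    by (simp add: digital_circle_def m_def M_def D_def)
  also have "\<dots> \<longleftrightarrow> 0 \<le> D \<and> M\<^sup>2 - M < D \<and> D \<le> M\<^sup>2 + M"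
    unfolding lower[symmetric] upper[symmetric] by linarith
  also have "\<dots> \<longleftrightarrow> i\<^sup>2 + j\<^sup>2 - M < (int r)\<^sup>2 \<and> (int r)\<^sup>2 \<le> i\<^sup>2 + j\<^sup>2 + M"
    using nonneg unfolding sum D_def by linarith
  finally show ?thesis unfolding M_def .
qed

lemma origin_mem_digital_circle: "(0, 0) \<in> digital_circle 0"
  by (simp add: digital_circle_def)

text \<open>Shows that some square, namely that of \<open>r\<close>, lies above the lower end of the
  pixel's interval, so that a least such square exists and its root is at most
  \<open>r\<close>.\<close>

lemma digital_disc_lower_bound:
  assumes "(i, j) \<in> digital_disc r" and "0 \<le> i" and "i \<le> j" and "0 < j"
  shows "i\<^sup>2 + j\<^sup>2 - j < (int r)\<^sup>2"
proof -
  obtain c where c: "(c, j) \<in> digital_circle r" "min 0 c \<le> i" "i \<le> max 0 c"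
    using assms(1) by (auto simp: digital_disc_def)
  have "c\<^sup>2 + j\<^sup>2 - max \<bar>c\<bar> j < (int r)\<^sup>2"
    using c(1) assms(4) by (simp add: mem_digital_circle_iff)
  moreover have "i\<^sup>2 - j \<le> c\<^sup>2 - max \<bar>c\<bar> j"
  proof (cases "\<bar>c\<bar> \<le> j")
    case True
    have "i\<^sup>2 \<le> c\<^sup>2" using c(3) assms(2) by (simp add: abs_le_square_iff[symmetric])
    with True show ?thesis by simp
  next
    case False
    \<comment> \<open>The circle pixel of row \<open>j\<close> may lie beyond the diagonal, where
      the maximum is \<open>\<bar>c\<bar> \<ge> j + 1\<close>.\<close>
    then have "j * j \<le> \<bar>c\<bar> * (\<bar>c\<bar> - 1)" using assms(4) by (intro mult_mono) auto
    moreover have "\<bar>c\<bar> * (\<bar>c\<bar> - 1) = c\<^sup>2 - \<bar>c\<bar>"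
      by (simp add: power2_eq_square right_diff_distrib)
    moreover have "i\<^sup>2 \<le> j * j" using assms(2,3) by (simp add: power2_eq_square mult_mono)
    ultimately show ?thesis using False assms(4) by simp
  qed
  ultimately show ?thesis by linarith
qed

lemma disc_absentee_between_squares:
  assumes "(i, j) \<in> disc_absentees r" and "0 \<le> i" and "i \<le> j"
  obtains h :: nat where "(j + int h)\<^sup>2 \<le> i\<^sup>2 + j\<^sup>2 - j" and "i\<^sup>2 + j\<^sup>2 + j < (j + int h + 1)\<^sup>2"
proof -
  have off: "(i, j) \<notin> digital_circle s" if "s \<le> r" for s
    using assms(1) that by (auto simp: disc_absentees_def)
  have "j \<noteq> 0"
    using off[of 0] origin_mem_digital_circle assms(2,3) by (metis antisym zero_le)
  then have "0 < j" using assms(2,3) by linarith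
  define N where "N = i\<^sup>2 + j\<^sup>2 - j"
  have r: "N < (int r)\<^sup>2"
    unfolding N_def using assms \<open>0 < j\<close> by (intro digital_disc_lower_bound) (auto simp: disc_absentees_def)
  have gap: "N + 2 * j < (int s)\<^sup>2" if "s \<le> r" "N < (int s)\<^sup>2" for s
    using off[OF that(1)] that(2) assms(2,3) \<open>0 < j\<close> by (simp add: mem_digital_circle_iff N_def)
  \<comment> \<open>Absence is known only for radii up to \<open>r\<close>, so
    \<open>j \<le> int r\<close> must precede the use of \<open>gap\<close> at radius
    \<open>j\<close>.\<close>
  have "(j - 1)\<^sup>2 \<le> N"
    using \<open>0 < j\<close> zero_le_power2[of i] power2_diff[of j 1] unfolding N_def power_one by linarith
  then have "(j - 1)\<^sup>2 < (int r)\<^sup>2" using r by linarith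
  then have "j \<le> int r" using power_less_imp_less_base[of "j - 1" 2 "int r"] by simp
  \<comment> \<open>This is what makes \<open>h\<close> nonnegative: otherwise \<open>gap\<close>
    would put \<open>i\<^sup>2 + j\<^sup>2 + j\<close> below \<open>j\<^sup>2\<close>.\<close>
  have j: "j\<^sup>2 \<le> N"
  proof (rule ccontr)
    assume "\<not> j\<^sup>2 \<le> N"
    then have "N + 2 * j < j\<^sup>2" using gap[of "nat j"] \<open>j \<le> int r\<close> \<open>0 < j\<close> by simp
    then show False using \<open>0 < j\<close> zero_le_power2[of i] unfolding N_def by linarith
  qed
  \<comment> \<open>\<open>n\<close> is the successor of the maximal root \<open>s\<close>;
    \<open>j < int n\<close> keeps the natural subtractions in \<open>h\<close> from
    truncating.\<close>
  define n where "n = (LEAST n. N < (int n)\<^sup>2)"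
  have n: "N < (int n)\<^sup>2" "n \<le> r"
    unfolding n_def by (rule LeastI[of _ r] Least_le, rule r)+
  have "j\<^sup>2 < (int n)\<^sup>2" using j n by linarith
  then have "j < int n" using power_less_imp_less_base[of j 2 "int n"] by simp
  define h where "h = n - 1 - nat j"
  have h: "j + int h = int (n - 1)" "j + int h + 1 = int n"
    using \<open>j < int n\<close> \<open>0 < j\<close> by (simp_all add: h_def)
  have "(int (n - 1))\<^sup>2 \<le> N"
    using not_less_Least[of "n - 1" "\<lambda>n. N < (int n)\<^sup>2"] \<open>j < int n\<close> \<open>0 < j\<close> by (simp add: n_def[symmetric] not_less)
  moreover have "N + 2 * j < (int n)\<^sup>2" using gap n by simp
  ultimately show ?thesis using h that[of h] unfolding N_def by auto
qed

text \<open>Cancelling \<open>j\<^sup>2\<close> leaves bounds on \<open>i\<^sup>2\<close>, the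
  constant value of \<open>x\<^sup>2 + z\<^sup>2\<close> on the circle, so one \<open>h\<close>
  serves all its points.\<close>

lemma real_circle_subset_P:
  assumes "(j + int h)\<^sup>2 \<le> i\<^sup>2 + j\<^sup>2 - j" and "i\<^sup>2 + j\<^sup>2 + j < (j + int h + 1)\<^sup>2"
  shows "real_circle i j \<subseteq> P h"
proof -
  have "(2 * int h + 1) * j + (int h)\<^sup>2 \<le> i\<^sup>2" "i\<^sup>2 < (2 * int h + 1) * j + (int h + 1)\<^sup>2"
    using assms by (simp_all add: power2_eq_square algebra_simps)
  then have "real_of_int ((2 * int h + 1) * j + (int h)\<^sup>2) \<le> real_of_int (i\<^sup>2)"
    "real_of_int (i\<^sup>2) < real_of_int ((2 * int h + 1) * j + (int h + 1)\<^sup>2)"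
    by (simp_all only: of_int_le_iff of_int_less_iff)
  then show ?thesis by (auto simp: real_circle_def P_def P_upper_def P_lower_def)
qed

text \<open>Keep the coordinate of smaller absolute value and move the other one onto the real
  circle; the definition bounds this move by 1/2.\<close>

lemma digital_circle_near_circle:
  assumes "(x, z) \<in> digital_circle r"
  obtains u w where "u\<^sup>2 + w\<^sup>2 = (real r)\<^sup>2"
    and "\<bar>u - of_int x\<bar> < 1/2" and "\<bar>w - of_int z\<bar> < 1/2"
proof -
  have near: "\<exists>w. (real_of_int a)\<^sup>2 + w\<^sup>2 = (real r)\<^sup>2 \<and> \<bar>w - of_int b\<bar> < 1/2"
    if "\<bar>a\<bar> \<le> int r" "\<bar>\<bar>real_of_int b\<bar> - sqrt (real_of_int ((int r)\<^sup>2 - a\<^sup>2))\<bar> < 1/2" for a b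
  proof -
    define q where "q = sqrt (real_of_int ((int r)\<^sup>2 - a\<^sup>2))"
    have "a\<^sup>2 \<le> (int r)\<^sup>2" using that(1) by (simp add: abs_le_square_iff[symmetric])
    then have "real_of_int (a\<^sup>2) \<le> real_of_int ((int r)\<^sup>2)" by (simp only: of_int_le_iff)
    then have "(real_of_int a)\<^sup>2 + q\<^sup>2 = (real r)\<^sup>2" by (simp add: q_def)
    \<comment> \<open>The definition compares only absolute values, so the root takes the sign of
      \<open>b\<close>.\<close>
    moreover have "\<bar>(if b < 0 then - q else q) - of_int b\<bar> < 1/2"
      using that(2) unfolding q_def[symmetric] by (auto simp: abs_if split: if_splits)
    ultimately show ?thesis by (intro exI[of _ "if b < 0 then - q else q"]) simp
  qed
  show thesis
  proof (cases "\<bar>x\<bar> \<le> \<bar>z\<bar>")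
    case True
    then have "\<exists>w. (real_of_int x)\<^sup>2 + w\<^sup>2 = (real r)\<^sup>2 \<and> \<bar>w - of_int z\<bar> < 1/2"
      using assms by (intro near) (simp_all add: digital_circle_def min_def max_def)
    then show thesis using that[of "real_of_int x"] by auto
  next
    case False
    then have "\<exists>w. (real_of_int z)\<^sup>2 + w\<^sup>2 = (real r)\<^sup>2 \<and> \<bar>w - of_int x\<bar> < 1/2"
      using assms by (intro near) (simp_all add: digital_circle_def min_def max_def)
    then show thesis using that[of _ "real_of_int z"] by (auto simp: add.commute)
  qed
qed

lemma absentee_circle_subset_digitization:
  assumes "0 \<le> i"
  shows "absentee_circle i j \<subseteq> digitization (real_circle i j)"
proof (clarsimp simp: absentee_circle_def)
  fix x z
  assume "(x, z) \<in> digital_circle (nat i)"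
  then show "(x, j, z) \<in> digitization (real_circle i j)"
    using assms by (elim digital_circle_near_circle) (auto simp: digitization_def real_circle_def)
qed

lemma digitization_mono: "A \<subseteq> B \<Longrightarrow> digitization A \<subseteq> digitization B"
  unfolding digitization_def by blast

theorem theorem9:
  fixes r :: nat and i j :: int
  assumes "(i, j) \<in> disc_absentees r"
    and "0 \<le> i" and "i \<le> j"
  shows "\<exists>h. real_circle i j \<subseteq> P h \<and>
    {v \<in> absentee_circle i j \<inter> octant1. real_point v \<in> real_circle i j} \<subseteq> F1 h \<and>
    absentee_circle i j \<subseteq> digitization (P h)"
proof -
  obtain h where "(j + int h)\<^sup>2 \<le> i\<^sup>2 + j\<^sup>2 - j" "i\<^sup>2 + j\<^sup>2 + j < (j + int h + 1)\<^sup>2"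
    using assms by (rule disc_absentee_between_squares)
  then have P: "real_circle i j \<subseteq> P h" by (rule real_circle_subset_P)
  moreover have "absentee_circle i j \<subseteq> digitization (P h)"
    using absentee_circle_subset_digitization[OF assms(2)] digitization_mono[OF P] by blast
  \<comment> \<open>The clause on \<open>F1 h\<close> restricts the first inclusion to voxels of
    Octant 1.\<close>
  ultimately show ?thesis by (auto simp: F1_def)
qed

end
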